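(* Assume that $\gamma: Q\to T^*Q$ is a one-form on $Q$, and $\lambda=\gamma\circ\pi_Q: T^*Q\to T^*Q$. Then the following two assertions hold. (i) For any $x,y\in TQ$, $\gamma^*\omega(x,y)=-\mathbf{d}\gamma(x,y)$; and for any $v,w\in TT^*Q$, $\lambda^*\omega(v,w)=-\mathbf{d}\gamma(T\pi_Q(v),\,T\pi_Q(w))$, since $\omega$ is the canonical symplectic form on $T^*Q$. (ii) For any $v,w\in TT^*Q$, $$\omega(T\lambda\cdot v,\,w)=\omega(v,\,w-T\lambda\cdot w)-\mathbf{d}\gamma(T\pi_Q(v),\,T\pi_Q(w)).$$
   Context: All manifolds are real, smooth and finite dimensional. $Q$ is a smooth manifold, $TQ$ its tangent bundle, $T^*Q$ its cotangent bundle with the canonical symplectic form $\omega=-\mathbf{d}\theta$, where $\theta$ is the canonical one-form on $T^*Q$. $\pi_Q: T^*Q\to Q$ is the projection, with tangent map $T\pi_Q: TT^*Q\to TQ$, and $T\lambda: TT^*Q\to TT^*Q$ is the tangent map of $\lambda$. A one-form $\gamma$ on $Q$ is regarded as the map $\gamma: Q\to T^*Q$, $q\mapsto(q,\gamma(q))$, with $\gamma(q)\in T_q^*Q$, and $\mathbf{d}\gamma$ is its exterior derivative.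
   Formalization: In (ii), v and w are tangent vectors at a common point z of T*Q with λ(z) = z (i.e. z in the image of γ); elsewhere ω(Tλ·v, w) and w − Tλ·w combine vectors at different base points and are undefined. *)

theory Defs
  imports "HOL-Analysis.Analysis"
begin

section \<open>Smooth maps between open sets of finite-dimensional normed spaces\<close>

text \<open>For open \<open>S\<close> in a finite-dimensional space, the \<open>C\<^sup>k\<close> condition on the derivative
  \<open>x \<mapsto> Df(x)\<close> is equivalent to the \<open>C\<^sup>k\<close> condition on \<open>x \<mapsto> Df(x)u\<close> for every fixed \<open>u\<close>;
  the latter keeps the type of the codomain constant along the recursion.\<close>

fun Ck_on :: "nat \<Rightarrow> 'a::real_normed_vector set \<Rightarrow> ('a \<Rightarrow> 'b::real_normed_vector) \<Rightarrow> bool" where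
  "Ck_on 0 S f \<longleftrightarrow> continuous_on S f"
| "Ck_on (Suc k) S f \<longleftrightarrow>
     (\<forall>x\<in>S. f differentiable (at x)) \<and> (\<forall>u. Ck_on k S (\<lambda>x. frechet_derivative f (at x) u))"

definition smooth_on :: "'a::real_normed_vector set \<Rightarrow> ('a \<Rightarrow> 'b::real_normed_vector) \<Rightarrow> bool" where
  "smooth_on S f \<longleftrightarrow> (\<forall>k. Ck_on k S f)"


section \<open>Smooth manifolds\<close>

text \<open>A manifold is given by an atlas: a set of charts \<open>(U, \<phi>)\<close>, with \<open>\<phi>\<close> relevant on \<open>U\<close> only.
  Its points are those covered by the charts, and its topology is the one that makes the charts
  homeomorphisms onto open sets of the model space \<open>'e\<close>. Atlases need not be maximal.\<close>

type_synonym ('a, 'e) chart = "'a set \<times> ('a \<Rightarrow> 'e)"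
type_synonym ('a, 'e) atlas = "('a, 'e) chart set"

definition points :: "('a, 'e) atlas \<Rightarrow> 'a set" where
  "points M = \<Union> (fst ` M)"

definition charts_at :: "('a, 'e) atlas \<Rightarrow> 'a \<Rightarrow> ('a, 'e) chart set" where
  "charts_at M p = {c \<in> M. p \<in> fst c}"

definition chart_inv :: "('a, 'e) chart \<Rightarrow> 'e \<Rightarrow> 'a" where
  "chart_inv c = inv_into (fst c) (snd c)"

text \<open>The local representative of a map \<open>f\<close> with respect to charts \<open>c\<close> (source) and \<open>d\<close> (target).\<close>

definition local_rep :: "('a, 'e) chart \<Rightarrow> ('b, 'f) chart \<Rightarrow> ('a \<Rightarrow> 'b) \<Rightarrow> 'e \<Rightarrow> 'f" where
  "local_rep c d f = snd d \<circ> f \<circ> chart_inv c"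

text \<open>Openness of the sets below expresses continuity of \<open>f\<close> for the atlas topologies.\<close>

definition smooth_map ::
  "('a, 'e::real_normed_vector) atlas \<Rightarrow> ('b, 'f::real_normed_vector) atlas \<Rightarrow> ('a \<Rightarrow> 'b) \<Rightarrow> bool" where
  "smooth_map M N f \<longleftrightarrow>
     (\<forall>p\<in>points M. f p \<in> points N) \<and>
     (\<forall>c\<in>M. \<forall>d\<in>N.
        open (snd c ` {p \<in> fst c. f p \<in> fst d}) \<and>
        smooth_on (snd c ` {p \<in> fst c. f p \<in> fst d}) (local_rep c d f))"

definition smooth_atlas :: "('a, 'e::real_normed_vector) atlas \<Rightarrow> bool" where
  "smooth_atlas M \<longleftrightarrow>
     (\<forall>c\<in>M. inj_on (snd c) (fst c) \<and> open (snd c ` fst c)) \<and>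
     (\<forall>c\<in>M. \<forall>d\<in>M.
        open (snd c ` (fst c \<inter> fst d)) \<and>
        smooth_on (snd c ` (fst c \<inter> fst d)) (local_rep c d id))"

definition atlas_topology :: "('a, 'e::real_normed_vector) atlas \<Rightarrow> 'a topology" where
  "atlas_topology M =
     topology (\<lambda>W. W \<subseteq> points M \<and> (\<forall>c\<in>M. open (snd c ` (W \<inter> fst c))))"

text \<open>The model space is any finite-dimensional real normed space, dimension 0 included.\<close>

definition smooth_manifold :: "('a, 'e::real_normed_vector) atlas \<Rightarrow> bool" where
  "smooth_manifold M \<longleftrightarrow>
     (\<exists>B::'e set. finite B \<and> span B = UNIV) \<and>
     smooth_atlas M \<and>
     Hausdorff_space (atlas_topology M) \<and>
     second_countable (atlas_topology M)"


section \<open>Tangent and cotangent vectors\<close>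

text \<open>A tangent vector at \<open>p\<close> assigns to each chart at \<open>p\<close> its components in that chart, subject to
  the transformation law given by the derivatives of the chart changes. It is set to \<open>0\<close> on all
  other charts, so that equal tangent vectors are equal functions. The vector space operations
  are the pointwise ones.\<close>

type_synonym ('a, 'e) tvec = "('a, 'e) chart \<Rightarrow> 'e"

definition tangent_space ::
  "('a, 'e::real_normed_vector) atlas \<Rightarrow> 'a \<Rightarrow> ('a, 'e) tvec set" where
  "tangent_space M p = {v.
     (\<forall>c\<in>charts_at M p. \<forall>d\<in>charts_at M p.
        v d = frechet_derivative (local_rep c d id) (at (snd c p)) (v c)) \<and>
     (\<forall>c. c \<notin> charts_at M p \<longrightarrow> v c = 0)}"

text \<open>The tangent vector at \<open>p\<close> with components \<open>u\<close> in the chart \<open>c\<close>.\<close>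

definition coord_vector ::
  "('a, 'e::real_normed_vector) atlas \<Rightarrow> ('a, 'e) chart \<Rightarrow> 'a \<Rightarrow> 'e \<Rightarrow> ('a, 'e) tvec" where
  "coord_vector M c p u = (\<lambda>d.
     if d \<in> charts_at M p
     then frechet_derivative (local_rep c d id) (at (snd c p)) u else 0)"

text \<open>The tangent map \<open>T\<^sub>pf\<close>, computed in some chart at \<open>p\<close>; for smooth \<open>f\<close> the result does not
  depend on that chart.\<close>

definition tangent_map ::
  "('a, 'e::real_normed_vector) atlas \<Rightarrow> ('b, 'f::real_normed_vector) atlas \<Rightarrow> ('a \<Rightarrow> 'b) \<Rightarrow>
   'a \<Rightarrow> ('a, 'e) tvec \<Rightarrow> ('b, 'f) tvec" where
  "tangent_map M N f p v =
     (let c = (SOME c. c \<in> charts_at M p) in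
      (\<lambda>d. if d \<in> charts_at N (f p)
           then frechet_derivative (local_rep c d f) (at (snd c p)) (v c) else 0))"

text \<open>Covectors are the linear functionals on the tangent space, set to \<open>0\<close> off the tangent space.\<close>

definition cotangent_space ::
  "('a, 'e::real_normed_vector) atlas \<Rightarrow> 'a \<Rightarrow> (('a, 'e) tvec \<Rightarrow> real) set" where
  "cotangent_space M p = {\<alpha>.
     (\<forall>v\<in>tangent_space M p. \<forall>w\<in>tangent_space M p. \<alpha> (\<lambda>c. v c + w c) = \<alpha> v + \<alpha> w) \<and>
     (\<forall>r. \<forall>v\<in>tangent_space M p. \<alpha> (\<lambda>c. r *\<^sub>R v c) = r * \<alpha> v) \<and>
     (\<forall>v. v \<notin> tangent_space M p \<longrightarrow> \<alpha> v = 0)}"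


section \<open>The cotangent bundle\<close>

text \<open>The points of the cotangent bundle are the pairs \<open>(q, \<alpha>)\<close> with \<open>\<alpha>\<close> a covector at \<open>q\<close>, and the
  bundle projection is \<open>fst\<close>. A chart \<open>c\<close> of the base induces the canonical chart
  \<open>(q, \<alpha>) \<mapsto> (x, p)\<close>, where \<open>x\<close> are the coordinates of \<open>q\<close> and \<open>p\<close>, an element of the dual of the
  model space, collects the components of \<open>\<alpha>\<close>. Linear functionals on the model space are bounded
  because it is finite-dimensional.\<close>

type_synonym ('a, 'e) cpoint = "'a \<times> (('a, 'e) tvec \<Rightarrow> real)"

definition cotangent_chart ::
  "('a, 'e::real_normed_vector) atlas \<Rightarrow> ('a, 'e) chart \<Rightarrow>
   (('a, 'e) cpoint, 'e \<times> ('e \<Rightarrow>\<^sub>L real)) chart" where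
  "cotangent_chart M c =
     ({(q, \<alpha>). q \<in> fst c \<and> \<alpha> \<in> cotangent_space M q},
      (\<lambda>(q, \<alpha>). (snd c q, Blinfun (\<lambda>u. \<alpha> (coord_vector M c q u)))))"

definition cotangent_bundle ::
  "('a, 'e::real_normed_vector) atlas \<Rightarrow> (('a, 'e) cpoint, 'e \<times> ('e \<Rightarrow>\<^sub>L real)) atlas" where
  "cotangent_bundle M = cotangent_chart M ` M"


section \<open>Differential forms\<close>

text \<open>A one-form assigns a covector to each point; \<open>form_map \<gamma>\<close> is the same form viewed as a map
  from the manifold into its cotangent bundle.\<close>

type_synonym ('a, 'e) form1 = "'a \<Rightarrow> ('a, 'e) tvec \<Rightarrow> real"
type_synonym ('a, 'e) form2 = "'a \<Rightarrow> ('a, 'e) tvec \<Rightarrow> ('a, 'e) tvec \<Rightarrow> real"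

definition form_map :: "('a, 'e) form1 \<Rightarrow> 'a \<Rightarrow> ('a, 'e) cpoint" where
  "form_map \<gamma> q = (q, \<gamma> q)"

definition one_form :: "('a, 'e::real_normed_vector) atlas \<Rightarrow> ('a, 'e) form1 \<Rightarrow> bool" where
  "one_form M \<gamma> \<longleftrightarrow>
     (\<forall>q\<in>points M. \<gamma> q \<in> cotangent_space M q) \<and>
     smooth_map M (cotangent_bundle M) (form_map \<gamma>)"

text \<open>The exterior derivative of a one-form, in some chart \<open>c\<close> at \<open>p\<close>: with
  \<open>a x u = \<alpha>(\<phi>\<^sup>-\<^sup>1 x)(u)\<close> the local expression of \<open>\<alpha>\<close>, it is
  \<open>d\<alpha>(v, w) = D(a \<cdot> w)(x)(v) - D(a \<cdot> v)(x)(w)\<close>, that is, the local form of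
  \<open>d\<alpha>(X, Y) = X(\<alpha>(Y)) - Y(\<alpha>(X)) - \<alpha>([X, Y])\<close> (no factor 1/2). For smooth \<open>\<alpha>\<close> the result does
  not depend on the chart.\<close>

definition ext_deriv ::
  "('a, 'e::real_normed_vector) atlas \<Rightarrow> ('a, 'e) form1 \<Rightarrow> ('a, 'e) form2" where
  "ext_deriv M \<alpha> p v w =
     (let c = (SOME c. c \<in> charts_at M p);
          a = (\<lambda>x u. \<alpha> (chart_inv c x) (coord_vector M c (chart_inv c x) u))
      in frechet_derivative (\<lambda>x. a x (w c)) (at (snd c p)) (v c)
       - frechet_derivative (\<lambda>x. a x (v c)) (at (snd c p)) (w c))"

definition pullback2 ::
  "('a, 'e::real_normed_vector) atlas \<Rightarrow> ('b, 'f::real_normed_vector) atlas \<Rightarrow> ('a \<Rightarrow> 'b) \<Rightarrow>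
   ('b, 'f) form2 \<Rightarrow> ('a, 'e) form2" where
  "pullback2 M N f \<omega> p v w = \<omega> (f p) (tangent_map M N f p v) (tangent_map M N f p w)"

text \<open>The canonical one-form \<open>\<theta>\<^sub>z(v) = \<alpha>(T\<pi> v)\<close> at \<open>z = (q, \<alpha>)\<close> and the canonical symplectic form
  \<open>\<omega> = -d\<theta>\<close>.\<close>

definition canonical_one_form ::
  "('a, 'e::real_normed_vector) atlas \<Rightarrow>
   (('a, 'e) cpoint, 'e \<times> ('e \<Rightarrow>\<^sub>L real)) form1" where
  "canonical_one_form M z v =
     (if v \<in> tangent_space (cotangent_bundle M) z
      then snd z (tangent_map (cotangent_bundle M) M fst z v) else 0)"

definition canonical_symplectic_form ::
  "('a, 'e::real_normed_vector) atlas \<Rightarrow>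
   (('a, 'e) cpoint, 'e \<times> ('e \<Rightarrow>\<^sub>L real)) form2" where
  "canonical_symplectic_form M z v w =
     - ext_deriv (cotangent_bundle M) (canonical_one_form M) z v w"

end

theory Submission
  imports Defs
begin

text \<open>In the canonical chart of \<open>T\<^sup>*Q\<close> induced by a chart \<open>c\<close> of \<open>Q\<close>, the canonical one-form at
  \<open>(x, p)\<close> is \<open>(u, m) \<mapsto> p u\<close>, so that \<open>\<omega>((u, m), (u', m')) = m' u - m u'\<close>. With \<open>G\<close> the local expression
  of \<open>\<gamma>\<close>, the tangent maps of \<open>\<gamma>\<close> and \<open>\<lambda>\<close> are \<open>u \<mapsto> (u, DG(x)u)\<close> and \<open>(u, m) \<mapsto> (u, DG(x)u)\<close>, and both
  assertions become identities in \<open>DG(x)\<close>. As \<^const>\<open>ext_deriv\<close> may choose unrelated charts on \<open>Q\<close> and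
  on \<open>T\<^sup>*Q\<close>, one also needs that \<open>d\<gamma>\<close> is independent of the chart, which is the symmetry of the second
  derivative of the chart changes.\<close>

section \<open>Finite-dimensional normed spaces\<close>

text \<open>The model space is any normed space with a finite spanning set, so continuity of
  coordinates must be derived from the norm itself. In the induction the distance of the new vector
  \<open>a\<close> from \<open>span B\<close> controls its coefficient; the induction hypothesis,
  applied to what remains, controls the others.\<close>

lemma bounded_representation:
  fixes B :: "'e::real_normed_vector set"
  assumes "finite B" "independent B"
  shows "\<exists>K. \<forall>b\<in>B. \<forall>x\<in>span B. \<bar>representation B x b\<bar> \<le> K * norm x"
  using assms
proof (induction B rule: finite_induct)
  case empty
  then show ?case by simp
next
  case (insert a B)
  have ind: "independent B" and a: "a \<notin> span B"
    using insert by (auto simp: independent_insert)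
  obtain K where K: "\<And>b x. b \<in> B \<Longrightarrow> x \<in> span B \<Longrightarrow> \<bar>representation B x b\<bar> \<le> K * norm x"
    using insert.IH[OF ind] by blast
  \<comment> \<open>Coordinates on \<open>span B\<close> are continuous, so \<open>span B\<close> is closed and \<open>a\<close> has positive distance
    to it; this distance bounds the coefficient of \<open>a\<close>.\<close>
  have "a \<notin> closure (span B)"
  proof
    assume "a \<in> closure (span B)"
    then obtain y where y: "\<And>n::nat. y n \<in> span B" and lim: "y \<longlonglongrightarrow> a"
      by (auto simp: closure_sequential)
    have rep: "(\<Sum>b\<in>B. representation B (y n) b *\<^sub>R b) = y n" for n
      using sum_representation_eq[OF ind y insert(1)] by simp
    have "Cauchy (\<lambda>n. representation B (y n) b)" if b: "b \<in> B" for b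
    proof (rule metric_CauchyI)
      fix e :: real assume e: "e > 0"
      have "Cauchy y" using lim LIMSEQ_imp_Cauchy by blast
      \<comment> \<open>The sign of \<open>K\<close> is unknown, so \<open>\<bar>K\<bar> + 1\<close>
        serves as a positive divisor.\<close>
      moreover have "e / (\<bar>K\<bar> + 1) > 0" using e by simp
      ultimately obtain M where M: "\<And>m n. m \<ge> M \<Longrightarrow> n \<ge> M \<Longrightarrow> dist (y m) (y n) < e / (\<bar>K\<bar> + 1)"
        by (meson metric_CauchyD)
      show "\<exists>M. \<forall>m\<ge>M. \<forall>n\<ge>M. dist (representation B (y m) b) (representation B (y n) b) < e"
      proof (intro exI allI impI)
        fix m n assume mn: "m \<ge> M" "n \<ge> M"
        have "dist (representation B (y m) b) (representation B (y n) b)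
            = \<bar>representation B (y m - y n) b\<bar>"
          by (simp add: dist_real_def representation_diff[OF ind y y])
        also have "\<dots> \<le> K * norm (y m - y n)" using K[OF b span_diff[OF y y]] .
        also have "\<dots> \<le> (\<bar>K\<bar> + 1) * norm (y m - y n)" by (intro mult_right_mono) auto
        also have "\<dots> < e"
          using M[OF mn] by (simp add: dist_norm pos_less_divide_eq mult.commute)
        finally show "dist (representation B (y m) b) (representation B (y n) b) < e" .
      qed
    qed
    \<comment> \<open>Completeness of the reals gives limits of the coordinates, and these limits
      write \<open>a\<close> as a combination of \<open>B\<close>.\<close>
    then have "\<forall>b\<in>B. \<exists>l. (\<lambda>n. representation B (y n) b) \<longlonglongrightarrow> l"
      by (simp add: Cauchy_convergent_iff convergent_def)
    then obtain l where l: "\<And>b. b \<in> B \<Longrightarrow> (\<lambda>n. representation B (y n) b) \<longlonglongrightarrow> l b"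
      by metis
    have "(\<lambda>n. \<Sum>b\<in>B. representation B (y n) b *\<^sub>R b) \<longlonglongrightarrow> (\<Sum>b\<in>B. l b *\<^sub>R b)"
      by (intro tendsto_sum tendsto_scaleR l tendsto_const)
    then have "a = (\<Sum>b\<in>B. l b *\<^sub>R b)"
      using lim LIMSEQ_unique unfolding rep by blast
    then show False using a by (simp add: span_sum span_scale span_base)
  qed
  then obtain d where d: "d > 0" "\<And>y. y \<in> span B \<Longrightarrow> d \<le> dist y a"
    by (metis closure_approachable not_less)
  have coeff: "\<bar>representation (insert a B) x a\<bar> \<le> norm x / d"
    and rest: "b \<in> B \<Longrightarrow> \<bar>representation (insert a B) x b\<bar> \<le> \<bar>K\<bar> * (1 + norm a / d) * norm x"
    if x: "x \<in> span (insert a B)" for x b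
  proof -
    let ?r = "representation (insert a B) x"
    define y where "y = (\<Sum>b\<in>B. ?r b *\<^sub>R b)"
    have y: "y \<in> span B" by (auto simp: y_def intro: span_sum span_scale span_base)
    have xy: "x = ?r a *\<^sub>R a + y"
      using sum_representation_eq[OF insert.prems x, of "insert a B"] insert(1,2)
      by (simp add: y_def)
    have "\<bar>?r a\<bar> * d \<le> norm x"
    proof (cases "?r a = 0")
      case False
      \<comment> \<open>Dividing \<open>x = ?r a *\<^sub>R a + y\<close> by \<open>- ?r a\<close>
        produces a point of \<open>span B\<close> at distance
        \<open>norm x / \<bar>?r a\<bar>\<close> from \<open>a\<close>.\<close>
      have "d \<le> dist (- (1 / ?r a) *\<^sub>R y) a" by (intro d span_scale y)
      also have "\<dots> = norm ((- 1 / ?r a) *\<^sub>R x)"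
      proof -
        have "(- 1 / ?r a) *\<^sub>R x = (- 1 / ?r a) *\<^sub>R (?r a *\<^sub>R a + y)" using xy by simp
        also have "\<dots> = - (1 / ?r a) *\<^sub>R y - a" using False by (simp add: scaleR_add_right)
        finally show ?thesis by (simp add: dist_norm)
      qed
      also have "\<dots> = norm x / \<bar>?r a\<bar>" by (simp add: divide_inverse_commute)
      finally show ?thesis using False by (simp add: pos_le_divide_eq mult.commute)
    qed simp
    then show c: "\<bar>?r a\<bar> \<le> norm x / d" using d by (simp add: pos_le_divide_eq)
    assume b: "b \<in> B"
    have "norm y \<le> norm x + \<bar>?r a\<bar> * norm a"
      using norm_triangle_ineq4[of x "?r a *\<^sub>R a"] xy by (metis add_diff_cancel_left' norm_scaleR)
    also have "\<dots> \<le> norm x + norm x / d * norm a" by (intro add_left_mono mult_right_mono c) auto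
    finally have ny: "norm y \<le> norm x + norm x / d * norm a" .
    \<comment> \<open>Uniqueness of the expansion of \<open>y\<close>; the coefficient function is
      cut off outside \<open>B\<close>, as \<open>representation_eqI\<close> requires.\<close>
    have "?r b = representation B y b"
      using b insert(1,2) ind
      by (subst representation_eqI[OF ind y, of "\<lambda>b. if b \<in> B then ?r b else 0"])
         (auto simp: y_def intro!: sum.mono_neutral_cong_left split: if_splits)
    also have "\<bar>\<dots>\<bar> \<le> K * norm y" using K b y by blast
    also have "\<dots> \<le> \<bar>K\<bar> * norm y" by (intro mult_right_mono) auto
    also have "\<dots> \<le> \<bar>K\<bar> * (norm x + norm x / d * norm a)" by (intro mult_left_mono ny) auto
    finally show "\<bar>?r b\<bar> \<le> \<bar>K\<bar> * (1 + norm a / d) * norm x"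
      by (simp add: algebra_simps)
  qed
  have "\<bar>representation (insert a B) x b\<bar> \<le> (1 / d + \<bar>K\<bar> * (1 + norm a / d)) * norm x"
    if "x \<in> span (insert a B)" "b \<in> insert a B" for x b
  proof -
    have "0 \<le> norm x / d" "0 \<le> \<bar>K\<bar> * (1 + norm a / d) * norm x" using d by auto
    then show ?thesis using that coeff[OF that(1)] rest[OF that(1), of b] 
      by (auto simp: distrib_right)
  qed
  then show ?case by blast
qed

definition fin_dim :: "'e::real_vector itself \<Rightarrow> bool" where
  "fin_dim _ \<longleftrightarrow> (\<exists>B::'e set. finite B \<and> span B = UNIV)"

text \<open>A maximal independent subset of a finite spanning set is a basis, and its coordinates
  are continuous by \<open>bounded_representation\<close>. Later arguments use finite dimension
  through this finite sum.\<close>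

lemma fin_dim_dual_basis:
  assumes "fin_dim TYPE('e::real_normed_vector)"
  obtains B :: "'e::real_normed_vector set" and \<beta> :: "'e \<Rightarrow> 'e \<Rightarrow>\<^sub>L real"
  where "finite B" "\<And>x. x = (\<Sum>b\<in>B. blinfun_apply (\<beta> b) x *\<^sub>R b)"
proof -
  obtain S :: "'e set" where S: "finite S" "span S = UNIV"
    using assms by (auto simp: fin_dim_def)
  obtain B where B: "B \<subseteq> S" "independent B" "span B = UNIV"
    using maximal_independent_subset[of S] S(2) span_minimal[OF _ subspace_span]
    by (metis top.extremum_unique)
  have fin: "finite B" using B S finite_subset by blast
  obtain K where K: "\<And>b x. b \<in> B \<Longrightarrow> \<bar>representation B x b\<bar> \<le> K * norm x"
    using bounded_representation[OF fin B(2)] B(3) by blast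
  have bl: "bounded_linear (\<lambda>x. representation B x b)" if "b \<in> B" for b
    by (rule bounded_linear_intro[of _ K])
       (use B K that in \<open>auto simp: representation_add representation_scale mult.commute\<close>)
  show thesis
  proof (rule that[OF fin, of "\<lambda>b. Blinfun (\<lambda>x. representation B x b)"])
    fix x :: 'e
    have "x = (\<Sum>b\<in>B. representation B x b *\<^sub>R b)"
      using sum_representation_eq[OF B(2), of x B] fin B(3) by simp
    then show "x = (\<Sum>b\<in>B. blinfun_apply (Blinfun (\<lambda>x. representation B x b)) x *\<^sub>R b)"
      by (simp add: bounded_linear_Blinfun_apply[OF bl] cong: sum.cong)
  qed
qed

lemma fin_dim_linear_expansion:
  assumes "x = (\<Sum>b\<in>B. blinfun_apply (\<beta> b) x *\<^sub>R b)" "linear f"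
  shows "f x = (\<Sum>b\<in>B. blinfun_apply (\<beta> b) x *\<^sub>R f b)"
proof -
  have "f (\<Sum>b\<in>B. blinfun_apply (\<beta> b) x *\<^sub>R b) = (\<Sum>b\<in>B. blinfun_apply (\<beta> b) x *\<^sub>R f b)"
    by (simp add: linear_sum[OF assms(2)] linear_scale[OF assms(2)])
  then show ?thesis by (simp only: assms(1)[symmetric])
qed

text \<open>The dual basis expansion exhibits \<open>f\<close> as a finite sum of bounded maps. This
  is what makes \<open>Blinfun\<close> in \<open>cotangent_chart\<close> lose no
  information.\<close>

lemma fin_dim_bounded_linear:
  fixes f :: "'e::real_normed_vector \<Rightarrow> 'b::real_normed_vector"
  assumes "fin_dim TYPE('e)" "linear f"
  shows "bounded_linear f"
proof -
  obtain B :: "'e set" and \<beta> where B: "finite B" "\<And>x. x = (\<Sum>b\<in>B. blinfun_apply (\<beta> b) x *\<^sub>R b)"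
    using fin_dim_dual_basis[OF assms(1)] by blast
  have "f = (\<lambda>x. \<Sum>b\<in>B. blinfun_apply (\<beta> b) x *\<^sub>R f b)"
    using fin_dim_linear_expansion[OF B(2) assms(2)] by blast
  moreover have "bounded_linear (\<lambda>x. \<Sum>b\<in>B. blinfun_apply (\<beta> b) x *\<^sub>R f b)"
    by (intro bounded_linear_sum bounded_linear_scaleR_const blinfun.bounded_linear_right)
  ultimately show ?thesis by (rule ssubst[where P = bounded_linear])
qed

text \<open>\<open>F y\<close> is the combination of the fixed functionals \<open>\<beta> b\<close>
  with the scalar coefficients \<open>F y b\<close>, so differentiability can be tested on one
  argument at a time.\<close>

lemma fin_dim_blinfun_differentiable:
  fixes F :: "'x::real_normed_vector \<Rightarrow> 'e::real_normed_vector \<Rightarrow>\<^sub>L real"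
  assumes "fin_dim TYPE('e)" "\<And>u. (\<lambda>y. blinfun_apply (F y) u) differentiable (at x)"
  shows "F differentiable (at x)"
proof -
  obtain B :: "'e set" and \<beta> where B: "finite B" "\<And>x. x = (\<Sum>b\<in>B. blinfun_apply (\<beta> b) x *\<^sub>R b)"
    using fin_dim_dual_basis[OF assms(1)] by blast
  have "F = (\<lambda>y. \<Sum>b\<in>B. blinfun_apply (F y) b *\<^sub>R \<beta> b)"
  proof (rule ext, rule blinfun_eqI)
    fix y u
    have "linear (blinfun_apply (F y))"
      by (simp add: bounded_linear.linear blinfun.bounded_linear_right)
    from fin_dim_linear_expansion[OF B(2) this, of u]
    show "blinfun_apply (F y) u = blinfun_apply (\<Sum>b\<in>B. blinfun_apply (F y) b *\<^sub>R \<beta> b) u"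
      by (simp add: blinfun.sum_left blinfun.scaleR_left mult.commute)
  qed
  moreover have "(\<lambda>y. \<Sum>b\<in>B. blinfun_apply (F y) b *\<^sub>R \<beta> b) differentiable (at x)"
    using B(1) assms(2) by (intro differentiable_sum differentiable_scaleR) auto
  ultimately show ?thesis by (rule ssubst[where P = "\<lambda>F. F differentiable (at x)"])
qed

section \<open>Symmetry of second derivatives\<close>

text \<open>Mean value inequality for \<open>s \<mapsto> f (x + s u + t v) - f (x + s u)\<close> on \<open>[0, t]\<close>.\<close>

lemma second_difference_bound:
  fixes f :: "'e::real_normed_vector \<Rightarrow> 'b::real_normed_vector"
  assumes S: "open S" "x \<in> S"
    and f: "\<And>y. y \<in> S \<Longrightarrow> f differentiable (at y)"
    and h: "((\<lambda>y. frechet_derivative f (at y) u) has_derivative h') (at x)"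
    and e: "e > 0"
  shows "\<exists>d>0. \<forall>t. 0 < t \<and> t < d \<longrightarrow>
    norm (f (x + t *\<^sub>R u + t *\<^sub>R v) - f (x + t *\<^sub>R u) - f (x + t *\<^sub>R v) + f x - (t * t) *\<^sub>R h' v)
      \<le> e * (t * t)"
proof -
  define h where "h = (\<lambda>y. frechet_derivative f (at y) u)"
  \<comment> \<open>\<open>t * C\<close> bounds both displacements from \<open>x\<close> that occur
    below; the summand 1 keeps \<open>C\<close> positive when \<open>u\<close> and \<open>v\<close>
    vanish.\<close>
  define C where "C = norm u + norm v + 1"
  have C: "C > 0" by (simp add: C_def add_nonneg_pos)
  have h'_lin: "bounded_linear h'" using h by (rule has_derivative_bounded_linear)
  obtain r where r: "r > 0" "ball x r \<subseteq> S" using S by (meson open_contains_ball)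
  \<comment> \<open>Chosen so that two first-order errors, each at most
    \<open>e / (2 * C) * (t * C)\<close>, add up to \<open>e * t\<close>.\<close>
  have "e / (2 * C) > 0" using e C by simp
  then obtain d where d: "d > 0"
    "\<And>y. norm (y - x) < d \<Longrightarrow> norm (h y - h x - h' (y - x)) \<le> e / (2 * C) * norm (y - x)"
    using h unfolding h_def has_derivative_at_alt by blast
  show ?thesis
  proof (intro exI[of _ "min d r / C"] conjI allI impI)
    show "0 < min d r / C" using d r C by simp
    fix t :: real assume t: "0 < t \<and> t < min d r / C"
    then have tC: "t * C < d" "t * C < r" using C by (auto simp: pos_less_divide_eq)
    \<comment> \<open>The linear correction turns \<open>g t - g 0\<close> into the second
      difference minus \<open>(t * t) *\<^sub>R h' v\<close> and makes the derivative of
      \<open>g\<close> small.\<close>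
    define g where
      "g s = f (x + s *\<^sub>R u + t *\<^sub>R v) - f (x + s *\<^sub>R u) - s *\<^sub>R (t *\<^sub>R h' v)" for s
    have near: "norm (s *\<^sub>R u + t *\<^sub>R v) \<le> t * C" "norm (s *\<^sub>R u) \<le> t * C" if "s \<in> {0..t}" for s
    proof -
      have "norm (s *\<^sub>R u) \<le> t * norm u" using that by (auto intro: mult_right_mono)
      moreover have "norm (s *\<^sub>R u + t *\<^sub>R v) \<le> norm (s *\<^sub>R u) + norm (t *\<^sub>R v)"
        by (rule norm_triangle_ineq)
      moreover have "norm (t *\<^sub>R v) = t * norm v" using t by simp
      moreover have "0 \<le> t * norm v" using t by simp
      moreover have "t * C = t * norm u + t * norm v + t" by (simp add: C_def algebra_simps)
      ultimately show "norm (s *\<^sub>R u + t *\<^sub>R v) \<le> t * C" "norm (s *\<^sub>R u) \<le> t * C"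
        using t by linarith+
    qed
    have inS: "x + s *\<^sub>R u + t *\<^sub>R v \<in> S" "x + s *\<^sub>R u \<in> S" if "s \<in> {0..t}" for s
    proof -
      have "x + (s *\<^sub>R u + t *\<^sub>R v) \<in> ball x r" "x + s *\<^sub>R u \<in> ball x r"
        using near[OF that] tC unfolding mem_ball dist_commute[of x] by (simp_all add: dist_norm)
      then show "x + s *\<^sub>R u + t *\<^sub>R v \<in> S" "x + s *\<^sub>R u \<in> S" using r by (auto simp: add.assoc)
    qed
    have der: "(g has_derivative (\<lambda>k. k *\<^sub>R (h (x + s *\<^sub>R u + t *\<^sub>R v) - h (x + s *\<^sub>R u) - t *\<^sub>R h' v)))
        (at s within {0..t})" if s: "s \<in> {0..t}" for s
    proof -
      have D: "((\<lambda>s. f (a + s *\<^sub>R u)) has_derivative (\<lambda>k. k *\<^sub>R h (a + s *\<^sub>R u))) (at s within {0..t})"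
        if "a + s *\<^sub>R u \<in> S" for a
      proof -
        have *: "(f has_derivative frechet_derivative f (at (a + s *\<^sub>R u))) (at (a + s *\<^sub>R u))"
          using f[OF that] frechet_derivative_works by blast
        have "((\<lambda>s. a + s *\<^sub>R u) has_derivative (\<lambda>k. k *\<^sub>R u)) (at s within {0..t})"
          by (auto intro!: derivative_eq_intros)
        from has_derivative_compose[OF this *] 
        show ?thesis by (simp add: h_def linear_frechet_derivative[OF f[OF that]] linear_scale)
      qed
      have E: "((\<lambda>s. s *\<^sub>R (t *\<^sub>R h' v)) has_derivative (\<lambda>k. k *\<^sub>R (t *\<^sub>R h' v))) (at s within {0..t})"
        by (auto intro!: derivative_eq_intros)
      have eq: "x + s *\<^sub>R u + t *\<^sub>R v = (x + t *\<^sub>R v) + s *\<^sub>R u" for s by simp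
      show ?thesis
        using has_derivative_diff[OF has_derivative_diff[OF D[of "x + t *\<^sub>R v"] D[of x]] E] inS[OF s]
        unfolding g_def eq scaleR_diff_right by auto
    qed
    have bound: "norm (h (x + s *\<^sub>R u + t *\<^sub>R v) - h (x + s *\<^sub>R u) - t *\<^sub>R h' v) \<le> e * t"
      if s: "s \<in> {0..t}" for s
    proof -
      interpret h': bounded_linear h' by (rule h'_lin)
      let ?y = "x + s *\<^sub>R u + t *\<^sub>R v" and ?z = "x + s *\<^sub>R u"
      have y: "norm (?y - x) \<le> t * C" "norm (?z - x) \<le> t * C" using near[OF s] by (auto simp: add.assoc)
      have "h ?y - h ?z - t *\<^sub>R h' v = (h ?y - h x - h' (?y - x)) - (h ?z - h x - h' (?z - x))"
        by (simp add: h'.add h'.scaleR h'.diff)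
      also have "norm \<dots> \<le> norm (h ?y - h x - h' (?y - x)) + norm (h ?z - h x - h' (?z - x))"
        by (rule norm_triangle_ineq4)
      also have "\<dots> \<le> e / (2 * C) * norm (?y - x) + e / (2 * C) * norm (?z - x)"
        using y tC by (intro add_mono d) auto
      also have "\<dots> \<le> e / (2 * C) * (t * C) + e / (2 * C) * (t * C)"
        using y e C by (intro add_mono mult_left_mono) auto
      also have "\<dots> = e * t" using C by (simp add: field_simps)
      finally show ?thesis .
    qed
    have "norm (g t - g 0) \<le> (e * t) * norm (t - 0)"
    proof (rule differentiable_bound[OF _ der])
      fix s assume s: "s \<in> {0..t}"
      show "onorm (\<lambda>k. k *\<^sub>R (h (x + s *\<^sub>R u + t *\<^sub>R v) - h (x + s *\<^sub>R u) - t *\<^sub>R h' v)) \<le> e * t"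
        using mult_left_mono[OF bound[OF s] abs_ge_zero]
        by (intro onorm_le) (simp add: mult.commute)
    qed (use t in auto)
    then show "norm (f (x + t *\<^sub>R u + t *\<^sub>R v) - f (x + t *\<^sub>R u) - f (x + t *\<^sub>R v) + f x - (t * t) *\<^sub>R h' v)
      \<le> e * (t * t)"
      using t by (simp add: g_def algebra_simps)
  qed
qed

text \<open>The second difference is symmetric in \<open>u\<close> and \<open>v\<close>, and up to
  an error \<open>e * (t * t)\<close> it equals both \<open>(t * t) *\<^sub>R hu v\<close> and
  \<open>(t * t) *\<^sub>R hv u\<close>.\<close>

lemma symmetric_second_derivative:
  fixes f :: "'e::real_normed_vector \<Rightarrow> 'b::real_normed_vector"
  assumes S: "open S" "x \<in> S"
    and f: "\<And>y. y \<in> S \<Longrightarrow> f differentiable (at y)"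
    and u: "((\<lambda>y. frechet_derivative f (at y) u) has_derivative hu) (at x)"
    and v: "((\<lambda>y. frechet_derivative f (at y) v) has_derivative hv) (at x)"
  shows "hu v = hv u"
proof (rule ccontr)
  assume "hu v \<noteq> hv u"
  \<comment> \<open>With a third of the gap as tolerance, the two errors together cover only two
    thirds of it.\<close>
  define e where "e = norm (hu v - hv u) / 3"
  have e: "e > 0" using \<open>hu v \<noteq> hv u\<close> by (simp add: e_def)
  let ?\<Delta> = "\<lambda>t u v. f (x + t *\<^sub>R u + t *\<^sub>R v) - f (x + t *\<^sub>R u) - f (x + t *\<^sub>R v) + f x"
  obtain d1 where d1: "d1 > 0" "\<And>t. 0 < t \<and> t < d1 \<Longrightarrow>
      norm (?\<Delta> t u v - (t * t) *\<^sub>R hu v) \<le> e * (t * t)"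
    using second_difference_bound[OF S f u e] by blast
  obtain d2 where d2: "d2 > 0" "\<And>t. 0 < t \<and> t < d2 \<Longrightarrow>
      norm (?\<Delta> t v u - (t * t) *\<^sub>R hv u) \<le> e * (t * t)"
    using second_difference_bound[OF S f v e] by blast
  define t where "t = min d1 d2 / 2"
  have t: "0 < t" "t < d1" "t < d2" using d1(1) d2(1) by (auto simp: t_def)
  have "(t * t) *\<^sub>R (hu v - hv u)
      = (?\<Delta> t v u - (t * t) *\<^sub>R hv u) - (?\<Delta> t u v - (t * t) *\<^sub>R hu v)"
    by (simp add: algebra_simps)
  then have "norm ((t * t) *\<^sub>R (hu v - hv u))
      \<le> norm (?\<Delta> t v u - (t * t) *\<^sub>R hv u) + norm (?\<Delta> t u v - (t * t) *\<^sub>R hu v)"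
    using norm_triangle_ineq4 by metis
  also have "\<dots> \<le> e * (t * t) + e * (t * t)" using d1(2) d2(2) t by (intro add_mono) auto
  finally have "(t * t) * (3 * e) \<le> (t * t) * (2 * e)" by (simp add: e_def mult_ac)
  then show False using t e by simp
qed

section \<open>Tangent vectors in charts\<close>

definition chart_deriv :: "('a, 'e::real_normed_vector) chart \<Rightarrow> ('a, 'e) chart \<Rightarrow> 'a \<Rightarrow> 'e \<Rightarrow> 'e" where
  "chart_deriv c d p = frechet_derivative (local_rep c d id) (at (snd c p))"

text \<open>First-order differentiability of the chart changes suffices for the calculus of tangent
  vectors and tangent maps. The locale is used for \<open>Q\<close> and again for
  \<open>cotangent_bundle Q\<close>.\<close>

locale differentiable_atlas =
  fixes M :: "('a, 'e::real_normed_vector) atlas"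
  assumes inj_chart: "c \<in> M \<Longrightarrow> inj_on (snd c) (fst c)"
    and open_overlap: "c \<in> M \<Longrightarrow> d \<in> M \<Longrightarrow> open (snd c ` (fst c \<inter> fst d))"
    and differentiable_transition:
      "c \<in> M \<Longrightarrow> d \<in> M \<Longrightarrow> p \<in> fst c \<inter> fst d \<Longrightarrow> local_rep c d id differentiable (at (snd c p))"
begin

lemma charts_atD: "c \<in> charts_at M p \<Longrightarrow> c \<in> M" "c \<in> charts_at M p \<Longrightarrow> p \<in> fst c"
  by (auto simp: charts_at_def)

lemma open_chart: "c \<in> M \<Longrightarrow> open (snd c ` fst c)"
  using open_overlap[of c c] by simp

lemma chart_inv_chart [simp]: "c \<in> M \<Longrightarrow> p \<in> fst c \<Longrightarrow> chart_inv c (snd c p) = p"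
  by (simp add: chart_inv_def inj_chart)

lemma local_rep_chart [simp]: "c \<in> M \<Longrightarrow> p \<in> fst c \<Longrightarrow> local_rep c d f (snd c p) = snd d (f p)"
  by (simp add: local_rep_def)

text \<open>Derivatives are local and chart images are open, so local expressions need only be
  compared at coordinates of points, where \<open>chart_inv\<close> simplifies.\<close>

lemma has_derivative_transform_chart:
  assumes c: "c \<in> charts_at M p"
    and f: "(f has_derivative f') (at (snd c p))"
    and eq: "\<And>r. c \<in> charts_at M r \<Longrightarrow> f (snd c r) = g (snd c r)"
  shows "(g has_derivative f') (at (snd c p))"
  by (rule has_derivative_transform_within_open[OF f, where s = "snd c ` fst c"])
     (use charts_atD[OF c] open_chart eq in \<open>auto simp: charts_at_def\<close>)

lemma has_derivative_transition:
  assumes "c \<in> charts_at M p" "d \<in> charts_at M p"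
  shows "(local_rep c d id has_derivative chart_deriv c d p) (at (snd c p))"
  using differentiable_transition[of c d p] assms
  by (simp add: chart_deriv_def charts_at_def frechet_derivative_works)

lemma linear_chart_deriv:
  assumes "c \<in> charts_at M p" "d \<in> charts_at M p"
  shows "linear (chart_deriv c d p)"
  using has_derivative_transition[OF assms] has_derivative_linear by blast

text \<open>Chain rule: on the overlap the representative in \<open>c'\<close> is the one in
  \<open>c\<close> after the transition map.\<close>

lemma has_derivative_change_chart:
  assumes c: "c \<in> charts_at M p" and c': "c' \<in> charts_at M p"
    and f: "(local_rep c d f has_derivative f') (at (snd c p))"
  shows "(local_rep c' d f has_derivative (\<lambda>u. f' (chart_deriv c' c p u))) (at (snd c' p))"
proof -
  note mem = charts_atD[OF c] charts_atD[OF c']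
  have "((\<lambda>x. local_rep c d f (local_rep c' c id x)) has_derivative
      (\<lambda>u. f' (chart_deriv c' c p u))) (at (snd c' p))"
    using has_derivative_compose[OF has_derivative_transition[OF c' c]] f mem by simp
  then show ?thesis
    by (rule has_derivative_transform_within_open[where s = "snd c' ` (fst c' \<inter> fst c)"])
       (use mem open_overlap in auto)
qed

text \<open>The cocycle rule is the change of chart for the identity map, combined with uniqueness
  of derivatives.\<close>

lemma chart_deriv_comp:
  assumes "b \<in> charts_at M p" "c \<in> charts_at M p" "d \<in> charts_at M p"
  shows "chart_deriv c d p (chart_deriv b c p u) = chart_deriv b d p u"
proof -
  have "chart_deriv b d p = (\<lambda>u. chart_deriv c d p (chart_deriv b c p u))"
    by (rule has_derivative_unique[OF has_derivative_transition has_derivative_change_chart])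
       (use assms has_derivative_transition in auto)
  then show ?thesis by simp
qed

lemma chart_deriv_same:
  assumes "c \<in> charts_at M p"
  shows "chart_deriv c c p u = u"
proof -
  have "(local_rep c c id has_derivative (\<lambda>u. u)) (at (snd c p))"
    by (rule has_derivative_transform_chart[OF assms has_derivative_ident]) (simp add: charts_atD)
  then have "chart_deriv c c p = (\<lambda>u. u)"
    using has_derivative_unique has_derivative_transition[OF assms assms] by blast
  then show ?thesis by simp
qed

section \<open>Tangent vectors and tangent maps through the components in one chart\<close>

lemma coord_vector_apply:
  "d \<in> charts_at M p \<Longrightarrow> coord_vector M c p u d = chart_deriv c d p u"
  by (simp add: coord_vector_def chart_deriv_def)

lemma coord_vector_apply_same [simp]:
  "c \<in> charts_at M p \<Longrightarrow> coord_vector M c p u c = u"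
  by (simp add: coord_vector_apply chart_deriv_same)

lemma coord_vector_in_tangent_space:
  assumes "c \<in> charts_at M p"
  shows "coord_vector M c p u \<in> tangent_space M p"
  using chart_deriv_comp[OF assms] coord_vector_apply
  by (auto simp: tangent_space_def coord_vector_def chart_deriv_def)

lemma tangent_vector_change:
  assumes "v \<in> tangent_space M p" "c \<in> charts_at M p" "d \<in> charts_at M p"
  shows "v d = chart_deriv c d p (v c)"
  using assms unfolding tangent_space_def chart_deriv_def by blast

text \<open>Together with \<open>coord_vector_apply_same\<close> this identifies the tangent space
  with the model space. At charts not containing \<open>p\<close> both sides take the default value
  0.\<close>

lemma coord_vector_components:
  assumes "v \<in> tangent_space M p" "c \<in> charts_at M p"
  shows "coord_vector M c p (v c) = v"
proof
  fix d
  show "coord_vector M c p (v c) d = v d"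
  proof (cases "d \<in> charts_at M p")
    case True
    then show ?thesis
      by (simp only: coord_vector_apply tangent_vector_change[OF assms(1,2) True])
  next
    case False
    then have "v d = 0" using assms(1) unfolding tangent_space_def by blast
    with False show ?thesis by (simp add: coord_vector_def)
  qed
qed

lemma coord_vector_add:
  assumes "c \<in> charts_at M p"
  shows "coord_vector M c p (u + w) = (\<lambda>d. coord_vector M c p u d + coord_vector M c p w d)"
  using linear_add[OF linear_chart_deriv[OF assms]]
  by (auto simp: coord_vector_def chart_deriv_def)

lemma coord_vector_scaleR:
  assumes "c \<in> charts_at M p"
  shows "coord_vector M c p (r *\<^sub>R u) = (\<lambda>d. r *\<^sub>R coord_vector M c p u d)"
  using linear_scale[OF linear_chart_deriv[OF assms]]
  by (auto simp: coord_vector_def chart_deriv_def)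

text \<open>Frees \<open>tangent_map\<close> from its chosen source chart \<open>b\<close>: the
  chain rule factor \<open>chart_deriv b c p\<close> is absorbed by the transformation law of
  \<open>v\<close>.\<close>

lemma tangent_map_chart:
  assumes v: "v \<in> tangent_space M p" and c: "c \<in> charts_at M p" and d: "d \<in> charts_at N (f p)"
    and f: "(local_rep c d f has_derivative f') (at (snd c p))"
  shows "tangent_map M N f p v d = f' (v c)"
proof -
  define b where "b = (SOME b. b \<in> charts_at M p)"
  have b: "b \<in> charts_at M p" using c unfolding b_def by (rule someI)
  have "frechet_derivative (local_rep b d f) (at (snd b p)) = (\<lambda>u. f' (chart_deriv b c p u))"
    using frechet_derivative_at[OF has_derivative_change_chart[OF c b f]] by simp
  then show ?thesis
    using d tangent_vector_change[OF v b c] by (simp add: tangent_map_def b_def[symmetric])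
qed

end

section \<open>The cotangent bundle in canonical charts\<close>

locale fin_dim_smooth_atlas =
  fixes Q :: "('a, 'e::real_normed_vector) atlas"
  assumes fin_dim: "fin_dim TYPE('e)"
    and smooth: "smooth_atlas Q"
begin

sublocale differentiable_atlas Q
proof
  fix c d p assume "c \<in> Q" "d \<in> Q" "p \<in> fst c \<inter> fst d"
  moreover from this have "Ck_on (Suc 0) (snd c ` (fst c \<inter> fst d)) (local_rep c d id)"
    using smooth by (simp only: smooth_atlas_def smooth_on_def)
  ultimately show "local_rep c d id differentiable (at (snd c p))" by simp
qed (use smooth in \<open>auto simp: smooth_atlas_def\<close>)

text \<open>Second-order smoothness of the base atlas enters here. It gives differentiability of the
  momentum coordinates under chart changes and the symmetry used in
  \<open>ext_deriv_chart\<close>.\<close>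

lemma chart_deriv_differentiable:
  assumes c: "c \<in> charts_at Q p" and d: "d \<in> charts_at Q p"
  shows "(\<lambda>x. frechet_derivative (local_rep c d id) (at x) u) differentiable (at (snd c p))"
proof -
  note mem = charts_atD[OF c] charts_atD[OF d]
  have "Ck_on (Suc (Suc 0)) (snd c ` (fst c \<inter> fst d)) (local_rep c d id)"
    using smooth mem by (simp only: smooth_atlas_def smooth_on_def)
  then show ?thesis using mem by simp
qed

section \<open>Fibre coordinates and the atlas of the cotangent bundle\<close>

definition momentum :: "('a, 'e) chart \<Rightarrow> 'a \<Rightarrow> (('a, 'e) tvec \<Rightarrow> real) \<Rightarrow> 'e \<Rightarrow>\<^sub>L real" where
  "momentum c q \<alpha> = Blinfun (\<lambda>u. \<alpha> (coord_vector Q c q u))"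

text \<open>Inverse of \<open>momentum c q\<close> on the fibre, as \<open>momentum_covector\<close>
  and \<open>covector_momentum\<close> show; it vanishes off the tangent space because
  \<open>cotangent_space\<close> demands this.\<close>

definition covector :: "('a, 'e) chart \<Rightarrow> 'a \<Rightarrow> ('e \<Rightarrow>\<^sub>L real) \<Rightarrow> ('a, 'e) tvec \<Rightarrow> real" where
  "covector c q p v = (if v \<in> tangent_space Q q then blinfun_apply p (v c) else 0)"

lemma tangent_space_add:
  assumes "c \<in> charts_at Q q" "v \<in> tangent_space Q q" "w \<in> tangent_space Q q"
  shows "(\<lambda>d. v d + w d) \<in> tangent_space Q q"
  using coord_vector_in_tangent_space[OF assms(1), of "v c + w c"] assms
  by (simp add: coord_vector_add coord_vector_components)

lemma tangent_space_scaleR: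
  assumes "c \<in> charts_at Q q" "v \<in> tangent_space Q q"
  shows "(\<lambda>d. r *\<^sub>R v d) \<in> tangent_space Q q"
  using coord_vector_in_tangent_space[OF assms(1), of "r *\<^sub>R v c"] assms
  by (simp add: coord_vector_scaleR coord_vector_components)

text \<open>\<open>Blinfun\<close> is meaningful on bounded maps only; linearity of \<alpha> and
  finite dimension supply the boundedness.\<close>

lemma momentum_apply:
  assumes c: "c \<in> charts_at Q q" and \<alpha>: "\<alpha> \<in> cotangent_space Q q"
  shows "blinfun_apply (momentum c q \<alpha>) u = \<alpha> (coord_vector Q c q u)"
proof -
  have "linear (\<lambda>u. \<alpha> (coord_vector Q c q u))"
    by (rule linearI)
       (use \<alpha> coord_vector_in_tangent_space[OF c] in
         \<open>auto simp: coord_vector_add[OF c] coord_vector_scaleR[OF c] cotangent_space_def\<close>)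
  then show ?thesis
    unfolding momentum_def
    using bounded_linear_Blinfun_apply[OF fin_dim_bounded_linear[OF fin_dim]] by metis
qed

lemma covector_in_cotangent_space:
  assumes "c \<in> charts_at Q q"
  shows "covector c q p \<in> cotangent_space Q q"
  using tangent_space_add[OF assms] tangent_space_scaleR[OF assms]
  by (auto simp: cotangent_space_def covector_def blinfun.add_right blinfun.scaleR_right)

lemma momentum_covector:
  assumes "c \<in> charts_at Q q"
  shows "momentum c q (covector c q p) = p"
  by (rule blinfun_eqI)
     (use assms in \<open>simp add: momentum_apply covector_in_cotangent_space covector_def
       coord_vector_in_tangent_space\<close>)

lemma covector_momentum:
  assumes "c \<in> charts_at Q q" "\<alpha> \<in> cotangent_space Q q"
  shows "covector c q (momentum c q \<alpha>) = \<alpha>"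
proof
  fix v
  show "covector c q (momentum c q \<alpha>) v = \<alpha> v"
    using assms
    by (auto simp: covector_def momentum_apply coord_vector_components cotangent_space_def)
qed

lemma mem_cotangent_chart [simp]:
  "z \<in> fst (cotangent_chart Q c) \<longleftrightarrow> fst z \<in> fst c \<and> snd z \<in> cotangent_space Q (fst z)"
  by (auto simp: cotangent_chart_def)

lemma snd_cotangent_chart [simp]:
  "snd (cotangent_chart Q c) z = (snd c (fst z), momentum c (fst z) (snd z))"
  by (simp add: cotangent_chart_def momentum_def split_beta)

text \<open>Every functional on the model space is the momentum of some covector, so the fibre part
  of the image is everything. Openness of overlaps then follows from the base.\<close>

lemma image_cotangent_chart:
  assumes "c \<in> Q"
  shows "snd (cotangent_chart Q c) ` (fst (cotangent_chart Q c) \<inter> fst (cotangent_chart Q d))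
    = snd c ` (fst c \<inter> fst d) \<times> UNIV"
proof (intro equalityI subsetI)
  fix y assume "y \<in> snd c ` (fst c \<inter> fst d) \<times> (UNIV :: ('e \<Rightarrow>\<^sub>L real) set)"
  then obtain q p where q: "q \<in> fst c" "q \<in> fst d" and y: "y = (snd c q, p)" by auto
  have c: "c \<in> charts_at Q q" using assms q by (simp add: charts_at_def)
  show "y \<in> snd (cotangent_chart Q c) ` (fst (cotangent_chart Q c) \<inter> fst (cotangent_chart Q d))"
    by (rule image_eqI[of _ _ "(q, covector c q p)"])
       (use c q in \<open>auto simp: y momentum_covector covector_in_cotangent_space\<close>)
qed auto

lemma chart_inv_cotangent_chart:
  assumes c: "c \<in> charts_at Q q"
  shows "chart_inv (cotangent_chart Q c) (snd c q, p) = (q, covector c q p)"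
proof -
  have inj: "inj_on (snd (cotangent_chart Q c)) (fst (cotangent_chart Q c))"
  proof (rule inj_onI)
    fix z z' assume z: "z \<in> fst (cotangent_chart Q c)" "z' \<in> fst (cotangent_chart Q c)"
      and eq: "snd (cotangent_chart Q c) z = snd (cotangent_chart Q c) z'"
    have q: "fst z = fst z'" using z eq inj_chart[OF charts_atD(1)[OF c]] by (auto dest: inj_onD)
    have "c \<in> charts_at Q (fst z)" using z charts_atD[OF c] by (simp add: charts_at_def)
    then have "snd z = snd z'"
      using z eq q covector_momentum by (metis mem_cotangent_chart prod.inject snd_cotangent_chart)
    then show "z = z'" using q by (simp add: prod_eq_iff)
  qed
  have "chart_inv (cotangent_chart Q c) (snd (cotangent_chart Q c) (q, covector c q p))
      = (q, covector c q p)"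
    unfolding chart_inv_def using c
    by (intro inv_into_f_f[OF inj]) (simp add: covector_in_cotangent_space charts_atD)
  then show ?thesis using c by (simp add: momentum_covector)
qed

lemma local_rep_cotangent_chart:
  assumes "c \<in> charts_at Q q"
  shows "local_rep (cotangent_chart Q c) d f (snd c q, p) = snd d (f (q, covector c q p))"
  by (simp add: local_rep_def chart_inv_cotangent_chart[OF assms])

text \<open>With \<tau> the transition of the base, the map is \<open>(x, p) \<mapsto> (\<tau> x, p
  \<circ> D(\<tau>\<^sup>-\<^sup>1)(\<tau> x))\<close>. The second component is tested on a fixed
  \<open>u\<close> and is differentiable because the inverse transition is twice
  differentiable.\<close>

lemma differentiable_cotangent_transition:
  assumes c: "c \<in> charts_at Q q" and d: "d \<in> charts_at Q q"
  shows "local_rep (cotangent_chart Q c) (cotangent_chart Q d) id differentiable (at (snd c q, p))"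
proof -
  note mem = charts_atD[OF c] charts_atD[OF d]
  let ?S = "snd c ` (fst c \<inter> fst d) \<times> (UNIV :: ('e \<Rightarrow>\<^sub>L real) set)"
  let ?L = "local_rep (cotangent_chart Q c) (cotangent_chart Q d) id"
  have S: "open ?S" "(snd c q, p) \<in> ?S" using open_overlap[of c d] mem by (simp_all add: open_Times)
  have rep: "fst (?L y) = local_rep c d id (fst y)"
    "blinfun_apply (snd (?L y)) u =
      blinfun_apply (snd y) (frechet_derivative (local_rep d c id) (at (local_rep c d id (fst y))) u)"
    if y: "y \<in> ?S" for y u
  proof -
    obtain r m where r: "r \<in> fst c" "r \<in> fst d" and y: "y = (snd c r, m)" using y by auto
    have cd: "c \<in> charts_at Q r" "d \<in> charts_at Q r" using mem r by (auto simp: charts_at_def)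
    show "fst (?L y) = local_rep c d id (fst y)"
      using mem r cd by (simp add: y local_rep_cotangent_chart)
    show "blinfun_apply (snd (?L y)) u = blinfun_apply (snd y)
        (frechet_derivative (local_rep d c id) (at (local_rep c d id (fst y))) u)"
      using mem r cd
      by (simp add: y local_rep_cotangent_chart momentum_apply covector_in_cotangent_space
          covector_def coord_vector_in_tangent_space coord_vector_apply chart_deriv_def)
  qed
  have fst_deriv: "((\<lambda>y. local_rep c d id (fst y)) has_derivative (\<lambda>k. chart_deriv c d q (fst k)))
      (at (snd c q, p))"
    by (rule has_derivative_compose[OF has_derivative_fst[OF has_derivative_ident]])
       (use has_derivative_transition[OF c d] in \<open>simp only: fst_conv\<close>)
  have "((\<lambda>y. fst (?L y)) has_derivative (\<lambda>k. chart_deriv c d q (fst k))) (at (snd c q, p))"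
    by (rule has_derivative_transform_within_open[OF fst_deriv S]) (simp add: rep)
  moreover have "(\<lambda>y. snd (?L y)) differentiable (at (snd c q, p))"
  proof (rule fin_dim_blinfun_differentiable[OF fin_dim])
    fix u
    obtain H where H: "((\<lambda>x. frechet_derivative (local_rep d c id) (at x) u) has_derivative H)
        (at (snd d q))"
      using chart_deriv_differentiable[OF d c] unfolding differentiable_def by blast
    have "((\<lambda>x. frechet_derivative (local_rep d c id) (at x) u) has_derivative H)
        (at (local_rep c d id (fst (snd c q, p))))"
      using H mem by simp
    \<comment> \<open>Three successive facts: the chain rule through \<tau>, the product rule for
      the bilinear evaluation \<open>blinfun_apply\<close>, and the transfer to \<open>?L\<close> on
      the overlap.\<close>
    note has_derivative_compose[OF fst_deriv this]
    note blinfun.FDERIV[OF has_derivative_snd[OF has_derivative_ident] this]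
    note has_derivative_transform_within_open[OF this S rep(2)[symmetric]]
    then show "(\<lambda>y. blinfun_apply (snd (?L y)) u) differentiable (at (snd c q, p))"
      by (auto simp: differentiable_def)
  qed
  ultimately have "(\<lambda>y. (fst (?L y), snd (?L y))) differentiable (at (snd c q, p))"
    unfolding differentiable_def using has_derivative_Pair by blast
  then show ?thesis by simp
qed

sublocale total: differentiable_atlas "cotangent_bundle Q"
proof
  fix C D z assume "C \<in> cotangent_bundle Q" "D \<in> cotangent_bundle Q" and z: "z \<in> fst C \<inter> fst D"
  then obtain c d where cd: "c \<in> Q" "d \<in> Q" "C = cotangent_chart Q c" "D = cotangent_chart Q d"
    by (auto simp: cotangent_bundle_def)
  with z show "local_rep C D id differentiable (at (snd C z))"
    using differentiable_cotangent_transition[of c "fst z" d] by (simp add: charts_at_def)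
next
  fix C D assume "C \<in> cotangent_bundle Q" "D \<in> cotangent_bundle Q"
  then obtain c d where cd: "c \<in> Q" "d \<in> Q" "C = cotangent_chart Q c" "D = cotangent_chart Q d"
    by (auto simp: cotangent_bundle_def)
  then show "open (snd C ` (fst C \<inter> fst D))"
    using open_overlap by (simp only: image_cotangent_chart open_Times open_UNIV)
next
  fix C assume "C \<in> cotangent_bundle Q"
  then obtain c where c: "c \<in> Q" "C = cotangent_chart Q c"
    by (auto simp: cotangent_bundle_def)
  show "inj_on (snd C) (fst C)"
  proof (rule inj_on_inverseI)
    fix z assume z: "z \<in> fst C"
    then have "c \<in> charts_at Q (fst z)" using c by (simp add: charts_at_def)
    then show "chart_inv C (snd C z) = z"
      using z c by (simp add: chart_inv_cotangent_chart covector_momentum)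
  qed
qed

text \<open>The right-hand side involves only the base point, so all points of one fibre have the
  same charts.\<close>

lemma charts_at_cotangent_bundle:
  assumes "snd z \<in> cotangent_space Q (fst z)"
  shows "charts_at (cotangent_bundle Q) z = cotangent_chart Q ` charts_at Q (fst z)"
  using assms by (auto simp: charts_at_def cotangent_bundle_def)

lemma points_cotangent_bundleD:
  assumes "z \<in> points (cotangent_bundle Q)"
  shows "fst z \<in> points Q" "snd z \<in> cotangent_space Q (fst z)"
  using assms by (auto simp: points_def cotangent_bundle_def)

section \<open>The projection and the canonical forms in canonical charts\<close>

lemma has_derivative_transform_cotangent_chart:
  assumes c: "c \<in> charts_at Q (fst z)"
    and f: "(f has_derivative f') (at (snd (cotangent_chart Q c) z))"
    and eq: "\<And>r p. c \<in> charts_at Q r \<Longrightarrow> f (snd c r, p) = g (snd c r, p)"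
  shows "(g has_derivative f') (at (snd (cotangent_chart Q c) z))"
proof (rule has_derivative_transform_within_open[OF f])
  show "open (snd c ` fst c \<times> (UNIV :: ('e \<Rightarrow>\<^sub>L real) set))"
    using open_chart charts_atD[OF c] by (simp add: open_Times)
  show "f y = g y" if mem_y: "y \<in> snd c ` fst c \<times> UNIV" for y
  proof -
    obtain r p where "r \<in> fst c" and y: "y = (snd c r, p)" using mem_y by auto
    then have "c \<in> charts_at Q r" using charts_atD[OF c] by (simp add: charts_at_def)
    then show ?thesis using eq by (simp add: y)
  qed
qed (use charts_atD[OF c] in auto)

text \<open>In canonical coordinates the projection is \<open>(x, p) \<mapsto> x\<close>. Read in
  another chart \<open>d\<close> it is followed by the transition from \<open>c\<close> to
  \<open>d\<close>, whose derivative is already part of \<open>coord_vector\<close>.\<close>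

lemma tangent_map_projection:
  assumes c: "c \<in> charts_at Q (fst z)" and z: "snd z \<in> cotangent_space Q (fst z)"
    and v: "v \<in> tangent_space (cotangent_bundle Q) z"
  shows "tangent_map (cotangent_bundle Q) Q fst z v
    = coord_vector Q c (fst z) (fst (v (cotangent_chart Q c)))"
proof
  fix d
  show "tangent_map (cotangent_bundle Q) Q fst z v d
    = coord_vector Q c (fst z) (fst (v (cotangent_chart Q c))) d"
  proof (cases "d \<in> charts_at Q (fst z)")
    case d: True
    let ?C = "cotangent_chart Q c"
    have C: "?C \<in> charts_at (cotangent_bundle Q) z"
      using c z by (simp add: charts_at_cotangent_bundle)
    have "(local_rep c d id has_derivative chart_deriv c d (fst z)) (at (fst (snd ?C z)))"
      using has_derivative_transition[OF c d] by simp
    note has_derivative_compose[OF has_derivative_fst[OF has_derivative_ident] this]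
    then have "(local_rep ?C d fst has_derivative (\<lambda>k. chart_deriv c d (fst z) (fst k)))
        (at (snd ?C z))"
      by (rule has_derivative_transform_cotangent_chart[OF c])
         (simp add: charts_atD local_rep_cotangent_chart)
    from total.tangent_map_chart[OF v C d this] d show ?thesis
      by (simp add: coord_vector_apply)
  qed (simp add: tangent_map_def coord_vector_def Let_def)
qed

text \<open>The classical formula \<theta> = p dx. The left-hand side has the shape of the local
  expression \<open>a\<close> in \<open>ext_deriv\<close>.\<close>

lemma canonical_one_form_chart:
  assumes c: "c \<in> charts_at Q q"
  defines "C \<equiv> cotangent_chart Q c"
  shows "canonical_one_form Q (chart_inv C (snd c q, p))
      (coord_vector (cotangent_bundle Q) C (chart_inv C (snd c q, p)) u) = blinfun_apply p (fst u)"
proof -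
  let ?z = "(q, covector c q p)"
  have z: "snd ?z \<in> cotangent_space Q (fst ?z)" using covector_in_cotangent_space[OF c] by simp
  have C: "C \<in> charts_at (cotangent_bundle Q) ?z"
    using c charts_at_cotangent_bundle[OF z] by (simp add: C_def)
  let ?v = "coord_vector (cotangent_bundle Q) C ?z u"
  have v: "?v \<in> tangent_space (cotangent_bundle Q) ?z"
    by (rule total.coord_vector_in_tangent_space[OF C])
  have "tangent_map (cotangent_bundle Q) Q fst ?z ?v = coord_vector Q c q (fst u)"
    using tangent_map_projection[of c ?z ?v] c z v total.coord_vector_apply_same[OF C]
    by (simp add: C_def)
  then show ?thesis
    using v c by (simp add: C_def chart_inv_cotangent_chart canonical_one_form_def covector_def
        coord_vector_in_tangent_space)
qed

text \<open>The chart chosen by \<^const>\<open>ext_deriv\<close> at a point of the cotangent bundle depends on its base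
  point only.\<close>

lemma canonical_symplectic_form_chart:
  assumes q: "q \<in> points Q"
  obtains c where "c \<in> charts_at Q q"
    "\<And>\<alpha> v w. \<alpha> \<in> cotangent_space Q q \<Longrightarrow> canonical_symplectic_form Q (q, \<alpha>) v w =
      blinfun_apply (snd (w (cotangent_chart Q c))) (fst (v (cotangent_chart Q c)))
      - blinfun_apply (snd (v (cotangent_chart Q c))) (fst (w (cotangent_chart Q c)))"
proof -
  define C where "C = (SOME C. C \<in> cotangent_chart Q ` charts_at Q q)"
  have "cotangent_chart Q ` charts_at Q q \<noteq> {}" using q by (auto simp: points_def charts_at_def)
  then have "C \<in> cotangent_chart Q ` charts_at Q q" unfolding C_def by (rule some_in_eq[THEN iffD2])
  then obtain c where c: "c \<in> charts_at Q q" and Cc: "C = cotangent_chart Q c" by blast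
  show thesis
  proof (rule that[OF c], fold Cc)
    fix \<alpha> v w assume \<alpha>: "\<alpha> \<in> cotangent_space Q q"
    define a where "a = (\<lambda>x u. canonical_one_form Q (chart_inv C x)
      (coord_vector (cotangent_bundle Q) C (chart_inv C x) u))"
    \<comment> \<open>For fixed \<open>u\<close> the local expression is linear in the momentum and
      independent of the position, so its derivative is the same at every point of the
      chart.\<close>
    have a: "frechet_derivative (\<lambda>x. a x u) (at (snd C (q, \<alpha>))) = (\<lambda>k. blinfun_apply (snd k) (fst u))"
      for u
    proof -
      have "((\<lambda>y. blinfun_apply (snd y) (fst u)) has_derivative (\<lambda>k. blinfun_apply (snd k) (fst u)))
          (at (snd C (q, \<alpha>)))"
        by (auto intro!: derivative_eq_intros)
      then have "((\<lambda>y. a y u) has_derivative (\<lambda>k. blinfun_apply (snd k) (fst u)))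
          (at (snd C (q, \<alpha>)))"
        unfolding Cc
        by (rule has_derivative_transform_cotangent_chart[rotated])
           (use c canonical_one_form_chart in \<open>simp_all add: a_def Cc\<close>)
      then show ?thesis using frechet_derivative_at by metis
    qed
    have "(SOME C. C \<in> charts_at (cotangent_bundle Q) (q, \<alpha>)) = C"
      using \<alpha> by (simp add: charts_at_cotangent_bundle C_def)
    then show "canonical_symplectic_form Q (q, \<alpha>) v w =
        blinfun_apply (snd (w C)) (fst (v C)) - blinfun_apply (snd (v C)) (fst (w C))"
      using a by (simp add: canonical_symplectic_form_def ext_deriv_def a_def Let_def)
  qed
qed

end

section \<open>One-forms in charts\<close>

locale fin_dim_smooth_one_form = fin_dim_smooth_atlas Q
  for Q :: "('a, 'e::real_normed_vector) atlas" +
  fixes \<gamma> :: "('a, 'e) form1"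
  assumes one_form: "one_form Q \<gamma>"
begin

lemma covector_form: "c \<in> charts_at Q q \<Longrightarrow> \<gamma> q \<in> cotangent_space Q q"
  using one_form by (auto simp: one_form_def points_def charts_at_def)

text \<open>The map called G in the overview. In the lemmas below the letter \<open>G\<close> stands
  for its derivative at a point.\<close>

definition local_form :: "('a, 'e) chart \<Rightarrow> 'e \<Rightarrow> 'e \<Rightarrow>\<^sub>L real" where
  "local_form c x = momentum c (chart_inv c x) (\<gamma> (chart_inv c x))"

lemma local_form_apply:
  assumes "c \<in> charts_at Q q"
  shows "blinfun_apply (local_form c (snd c q)) u = \<gamma> q (coord_vector Q c q u)"
  using assms covector_form[OF assms] by (simp add: local_form_def charts_atD momentum_apply)

text \<open>Smoothness of \<open>form_map \<gamma>\<close>, read in \<open>c\<close> and the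
  canonical chart induced by \<open>c\<close>; the momentum component of this representative is
  \<open>local_form c\<close>.\<close>

lemma local_form_differentiable:
  assumes c: "c \<in> charts_at Q q"
  shows "local_form c differentiable (at (snd c q))"
proof -
  let ?C = "cotangent_chart Q c"
  have cQ: "c \<in> Q" "q \<in> fst c" using charts_atD[OF c] .
  have C: "?C \<in> cotangent_bundle Q" using cQ by (simp add: cotangent_bundle_def)
  have eq: "{p \<in> fst c. form_map \<gamma> p \<in> fst ?C} = fst c"
    using cQ covector_form[of c] by (auto simp: form_map_def charts_at_def)
  have "smooth_on (snd c ` {p \<in> fst c. form_map \<gamma> p \<in> fst ?C}) (local_rep c ?C (form_map \<gamma>))"
    using one_form cQ(1) C unfolding one_form_def smooth_map_def by blast
  then have "Ck_on (Suc 0) (snd c ` fst c) (local_rep c ?C (form_map \<gamma>))"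
    unfolding eq smooth_on_def by blast
  then obtain D where "(local_rep c ?C (form_map \<gamma>) has_derivative D) (at (snd c q))"
    using cQ by (auto simp: differentiable_def)
  then have "((\<lambda>x. snd (local_rep c ?C (form_map \<gamma>) x)) has_derivative (\<lambda>k. snd (D k))) (at (snd c q))"
    by (rule has_derivative_snd)
  moreover have "(\<lambda>x. snd (local_rep c ?C (form_map \<gamma>) x)) = local_form c"
    by (simp add: fun_eq_iff local_rep_def local_form_def form_map_def)
  ultimately show ?thesis by (auto simp: differentiable_def)
qed

text \<open>Exposes the chart \<open>b\<close> that \<open>ext_deriv\<close> selects, so that
  \<open>ext_deriv_chart\<close> can compare it with a given one.\<close>

lemma ext_deriv_some_chart:
  assumes c: "c \<in> charts_at Q q"
  obtains b where "b \<in> charts_at Q q"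
    "\<And>G v w. (local_form b has_derivative G) (at (snd b q)) \<Longrightarrow> ext_deriv Q \<gamma> q v w =
      blinfun_apply (G (v b)) (w b) - blinfun_apply (G (w b)) (v b)"
proof -
  define b where "b = (SOME b. b \<in> charts_at Q q)"
  have b: "b \<in> charts_at Q q" unfolding b_def using c by (rule someI)
  show thesis
  proof (rule that[OF b])
    fix G v w assume G: "(local_form b has_derivative G) (at (snd b q))"
    define a where "a = (\<lambda>x u. \<gamma> (chart_inv b x) (coord_vector Q b (chart_inv b x) u))"
    have "frechet_derivative (\<lambda>x. a x u) (at (snd b q)) = (\<lambda>k. blinfun_apply (G k) u)" for u
    proof -
      have "((\<lambda>x. blinfun_apply (local_form b x) u) has_derivative (\<lambda>k. blinfun_apply (G k) u))
          (at (snd b q))"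
        using bounded_linear.has_derivative[OF blinfun.bounded_linear_left G] .
      then have "((\<lambda>x. a x u) has_derivative (\<lambda>k. blinfun_apply (G k) u)) (at (snd b q))"
        by (rule has_derivative_transform_chart[OF b]) (simp add: a_def local_form_apply charts_atD)
      then show ?thesis using frechet_derivative_at by metis
    qed
    then show "ext_deriv Q \<gamma> q v w = blinfun_apply (G (v b)) (w b) - blinfun_apply (G (w b)) (v b)"
      by (simp add: ext_deriv_def a_def Let_def b_def[symmetric])
  qed
qed

text \<open>The second derivatives of the chart change cancel by symmetry.\<close>

lemma ext_deriv_chart:
  assumes c: "c \<in> charts_at Q q" and v: "v \<in> tangent_space Q q" and w: "w \<in> tangent_space Q q"
    and G: "(local_form c has_derivative G) (at (snd c q))"
  shows "ext_deriv Q \<gamma> q v w = blinfun_apply (G (v c)) (w c) - blinfun_apply (G (w c)) (v c)"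
proof -
  obtain b where b: "b \<in> charts_at Q q" and ext: "\<And>G. (local_form b has_derivative G) (at (snd b q)) \<Longrightarrow>
      ext_deriv Q \<gamma> q v w = blinfun_apply (G (v b)) (w b) - blinfun_apply (G (w b)) (v b)"
    using ext_deriv_some_chart[OF c] by metis
  note mem = charts_atD[OF b] charts_atD[OF c]
  obtain F where F: "(local_form b has_derivative F) (at (snd b q))"
    using local_form_differentiable[OF b] by (auto simp: differentiable_def)
  let ?S = "snd b ` (fst b \<inter> fst c)" and ?\<tau> = "local_rep b c id"
  have S: "open ?S" "snd b q \<in> ?S" using open_overlap mem by auto
  have trans: "(?\<tau> has_derivative chart_deriv b c q) (at (snd b q))"
    by (rule has_derivative_transition[OF b c])
  \<comment> \<open>\<open>H u k\<close> is the second derivative of the transition in the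
    directions \<open>k\<close> and \<open>u\<close>.\<close>
  define H where "H = (\<lambda>u. frechet_derivative (\<lambda>x. frechet_derivative ?\<tau> (at x) u) (at (snd b q)))"
  have H: "((\<lambda>x. frechet_derivative ?\<tau> (at x) u) has_derivative H u) (at (snd b q))" for u
    using chart_deriv_differentiable[OF b c] by (simp add: H_def frechet_derivative_works)
  have sym: "H u k = H k u" for u k
    by (rule symmetric_second_derivative[OF S _ H H])
       (use mem differentiable_transition[of b c] in auto)
  \<comment> \<open>Product rule applied to the transformation law
    \<open>local_form b x u = local_form c (?\<tau> x) (D?\<tau>(x) u)\<close>. The last term,
    symmetric in \<open>k\<close> and \<open>u\<close>, is the defect that antisymmetrization
    removes.\<close>
  have F_eq: "blinfun_apply (F k) u = blinfun_apply (G (chart_deriv b c q k)) (chart_deriv b c q u)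
      + blinfun_apply (local_form c (snd c q)) (H u k)" for k u
  proof -
    have "((\<lambda>x. local_form c (?\<tau> x)) has_derivative (\<lambda>k. G (chart_deriv b c q k))) (at (snd b q))"
      by (rule has_derivative_compose[OF trans])
         (use G mem in \<open>simp only: local_rep_chart id_apply\<close>)
    from blinfun.FDERIV[OF this H, of u]
    have 1: "((\<lambda>x. blinfun_apply (local_form c (?\<tau> x)) (frechet_derivative ?\<tau> (at x) u)) has_derivative
        (\<lambda>k. blinfun_apply (local_form c (snd c q)) (H u k) +
          blinfun_apply (G (chart_deriv b c q k)) (chart_deriv b c q u))) (at (snd b q))"
      using mem by (simp add: chart_deriv_def)
    have eq: "blinfun_apply (local_form c (?\<tau> x)) (frechet_derivative ?\<tau> (at x) u)
        = blinfun_apply (local_form b x) u" if mem_x: "x \<in> ?S" for x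
    proof -
      obtain r where r: "r \<in> fst b" "r \<in> fst c" and x: "x = snd b r" using mem_x by auto
      have bc: "b \<in> charts_at Q r" "c \<in> charts_at Q r" using r mem by (auto simp: charts_at_def)
      have "coord_vector Q c r (chart_deriv b c r u) = coord_vector Q b r u"
        using coord_vector_components[OF coord_vector_in_tangent_space[OF bc(1)] bc(2), of u] bc
        by (simp add: coord_vector_apply)
      then show ?thesis
        using bc r mem local_form_apply by (simp add: x chart_deriv_def)
    qed
    have 2: "((\<lambda>x. blinfun_apply (local_form b x) u) has_derivative (\<lambda>k. blinfun_apply (F k) u))
        (at (snd b q))"
      using bounded_linear.has_derivative[OF blinfun.bounded_linear_left F] .
    show ?thesis
      using has_derivative_unique[OF 2 has_derivative_transform_within_open[OF 1 S eq]]
      by (simp add: fun_eq_iff)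
  qed
  show ?thesis
    using ext[OF F] tangent_vector_change[OF v b c] tangent_vector_change[OF w b c]
    by (simp add: F_eq sym[of "v b" "w b"])
qed

section \<open>Tangent maps of \<gamma> and \<lambda> in canonical charts\<close>

lemma tangent_map_form:
  assumes c: "c \<in> charts_at Q q" and x: "x \<in> tangent_space Q q"
    and G: "(local_form c has_derivative G) (at (snd c q))"
  shows "tangent_map Q (cotangent_bundle Q) (form_map \<gamma>) q x (cotangent_chart Q c) = (x c, G (x c))"
proof (rule tangent_map_chart[OF x c])
  show "cotangent_chart Q c \<in> charts_at (cotangent_bundle Q) (form_map \<gamma> q)"
    using c covector_form[OF c] by (simp add: form_map_def charts_at_cotangent_bundle)
  show "(local_rep c (cotangent_chart Q c) (form_map \<gamma>) has_derivative (\<lambda>k. (k, G k))) (at (snd c q))"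
    by (rule has_derivative_transform_chart[OF c has_derivative_Pair[OF has_derivative_ident G]])
       (simp add: charts_atD local_form_def form_map_def)
qed

text \<open>The image point lies over the same base point as \<open>z\<close>, so the one chart
  \<open>C\<close> serves as source and target; there the map is
  \<open>(x, p) \<mapsto> (x, local_form c x)\<close>.\<close>

lemma tangent_map_form_projection:
  assumes c: "c \<in> charts_at Q (fst z)" and z: "snd z \<in> cotangent_space Q (fst z)"
    and v: "v \<in> tangent_space (cotangent_bundle Q) z"
    and G: "(local_form c has_derivative G) (at (snd c (fst z)))"
  defines "C \<equiv> cotangent_chart Q c"
  shows "tangent_map (cotangent_bundle Q) (cotangent_bundle Q) (form_map \<gamma> \<circ> fst) z v C
    = (fst (v C), G (fst (v C)))"
proof (rule total.tangent_map_chart[OF v])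
  show "C \<in> charts_at (cotangent_bundle Q) z"
    using c z by (simp add: C_def charts_at_cotangent_bundle)
  show "C \<in> charts_at (cotangent_bundle Q) ((form_map \<gamma> \<circ> fst) z)"
    using c covector_form[OF c] by (simp add: C_def form_map_def charts_at_cotangent_bundle)
  have "((\<lambda>y. (fst y, local_form c (fst y))) has_derivative (\<lambda>k. (fst k, G (fst k)))) (at (snd C z))"
    by (intro has_derivative_Pair has_derivative_fst has_derivative_ident
        has_derivative_compose[OF has_derivative_fst[OF has_derivative_ident]])
       (use G in \<open>simp add: C_def\<close>)
  then show "(local_rep C C (form_map \<gamma> \<circ> fst) has_derivative (\<lambda>k. (fst k, G (fst k)))) (at (snd C z))"
    unfolding C_def
    by (rule has_derivative_transform_cotangent_chart[OF c])
       (simp add: charts_atD local_rep_cotangent_chart form_map_def local_form_def)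
qed

section \<open>The pullback formulas and the identity for T\<lambda>\<close>

lemma pullback_form_map:
  assumes q: "q \<in> points Q" and x: "x \<in> tangent_space Q q" and y: "y \<in> tangent_space Q q"
  shows "pullback2 Q (cotangent_bundle Q) (form_map \<gamma>) (canonical_symplectic_form Q) q x y
    = - ext_deriv Q \<gamma> q x y"
proof -
  obtain c where c: "c \<in> charts_at Q q" and \<omega>:
    "\<And>\<alpha> v w. \<alpha> \<in> cotangent_space Q q \<Longrightarrow> canonical_symplectic_form Q (q, \<alpha>) v w =
      blinfun_apply (snd (w (cotangent_chart Q c))) (fst (v (cotangent_chart Q c)))
      - blinfun_apply (snd (v (cotangent_chart Q c))) (fst (w (cotangent_chart Q c)))"
    using canonical_symplectic_form_chart[OF q] by blast
  obtain G where G: "(local_form c has_derivative G) (at (snd c q))"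
    using local_form_differentiable[OF c] by (auto simp: differentiable_def)
  show ?thesis
    \<comment> \<open>On the images \<open>(x c, G (x c))\<close> and \<open>(y c, G (y c))\<close>
      the form \<omega> takes the value \<open>G (y c) (x c) - G (x c) (y c)\<close>, which is minus
      the local expression of d\<gamma>.\<close>
    using \<omega>[OF covector_form[OF c]]
    by (simp add: pullback2_def form_map_def[of \<gamma> q] tangent_map_form[OF c _ G] x y
        ext_deriv_chart[OF c x y G])
qed

text \<open>Provides a single chart in which \<omega>, T\<lambda> and the pullback of d\<gamma>
  along the projection are all explicit, leaving only algebra. The formula for \<omega> covers the
  whole fibre, hence both \<open>z\<close> and its image under \<lambda>.\<close>

lemma symplectic_form_projection_chart:
  assumes z: "z \<in> points (cotangent_bundle Q)"
  obtains c G where "c \<in> charts_at Q (fst z)"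
    "\<And>\<alpha> v w. \<alpha> \<in> cotangent_space Q (fst z) \<Longrightarrow> canonical_symplectic_form Q (fst z, \<alpha>) v w =
      blinfun_apply (snd (w (cotangent_chart Q c))) (fst (v (cotangent_chart Q c)))
      - blinfun_apply (snd (v (cotangent_chart Q c))) (fst (w (cotangent_chart Q c)))"
    "\<And>v. v \<in> tangent_space (cotangent_bundle Q) z \<Longrightarrow>
      tangent_map (cotangent_bundle Q) (cotangent_bundle Q) (form_map \<gamma> \<circ> fst) z v (cotangent_chart Q c)
        = (fst (v (cotangent_chart Q c)), G (fst (v (cotangent_chart Q c))))"
    "\<And>v w. v \<in> tangent_space (cotangent_bundle Q) z \<Longrightarrow> w \<in> tangent_space (cotangent_bundle Q) z \<Longrightarrow>
      ext_deriv Q \<gamma> (fst z) (tangent_map (cotangent_bundle Q) Q fst z v)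
        (tangent_map (cotangent_bundle Q) Q fst z w)
      = blinfun_apply (G (fst (v (cotangent_chart Q c)))) (fst (w (cotangent_chart Q c)))
        - blinfun_apply (G (fst (w (cotangent_chart Q c)))) (fst (v (cotangent_chart Q c)))"
proof -
  note pt = points_cotangent_bundleD[OF z]
  obtain c where c: "c \<in> charts_at Q (fst z)" and \<omega>:
    "\<And>\<alpha> v w. \<alpha> \<in> cotangent_space Q (fst z) \<Longrightarrow> canonical_symplectic_form Q (fst z, \<alpha>) v w =
      blinfun_apply (snd (w (cotangent_chart Q c))) (fst (v (cotangent_chart Q c)))
      - blinfun_apply (snd (v (cotangent_chart Q c))) (fst (w (cotangent_chart Q c)))"
    using canonical_symplectic_form_chart[OF pt(1)] by blast
  obtain G where G: "(local_form c has_derivative G) (at (snd c (fst z)))"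
    using local_form_differentiable[OF c] by (auto simp: differentiable_def)
  show thesis
    by (rule that[OF c \<omega> tangent_map_form_projection[OF c pt(2) _ G]])
       (simp_all add: tangent_map_projection[OF c pt(2)] c coord_vector_in_tangent_space
         ext_deriv_chart[OF c _ _ G])
qed

lemma pullback_form_map_projection:
  assumes z: "z \<in> points (cotangent_bundle Q)"
    and v: "v \<in> tangent_space (cotangent_bundle Q) z" and w: "w \<in> tangent_space (cotangent_bundle Q) z"
  shows "pullback2 (cotangent_bundle Q) (cotangent_bundle Q) (form_map \<gamma> \<circ> fst)
      (canonical_symplectic_form Q) z v w
    = - ext_deriv Q \<gamma> (fst z) (tangent_map (cotangent_bundle Q) Q fst z v)
        (tangent_map (cotangent_bundle Q) Q fst z w)"
  by (rule symplectic_form_projection_chart[OF z])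
     (use v w covector_form in \<open>simp add: pullback2_def form_map_def[of \<gamma> "fst z"]\<close>)

text \<open>Since \<open>T w\<close> and \<open>w\<close> have the same position component in the
  chart, \<open>w - T w\<close> is vertical and the momentum of \<open>v\<close> drops out of the
  right-hand side. What is left on both sides is the momentum of \<open>w\<close> on the position
  part of \<open>v\<close>, minus \<open>G\<close> of the position part of \<open>v\<close> on that
  of \<open>w\<close>.\<close>

lemma symplectic_form_tangent_map_projection:
  assumes z: "z \<in> points (cotangent_bundle Q)"
    and v: "v \<in> tangent_space (cotangent_bundle Q) z" and w: "w \<in> tangent_space (cotangent_bundle Q) z"
  defines "T \<equiv> tangent_map (cotangent_bundle Q) (cotangent_bundle Q) (form_map \<gamma> \<circ> fst) z"
  shows "canonical_symplectic_form Q z (T v) w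
    = canonical_symplectic_form Q z v (\<lambda>c. w c - T w c)
      - ext_deriv Q \<gamma> (fst z) (tangent_map (cotangent_bundle Q) Q fst z v)
          (tangent_map (cotangent_bundle Q) Q fst z w)"
  using symplectic_form_projection_chart[OF z]
proof cases
  case (1 c G)
  have \<omega>: "canonical_symplectic_form Q z v w =
      blinfun_apply (snd (w (cotangent_chart Q c))) (fst (v (cotangent_chart Q c)))
      - blinfun_apply (snd (v (cotangent_chart Q c))) (fst (w (cotangent_chart Q c)))" for v w
    using 1(2)[of "snd z" v w] points_cotangent_bundleD(2)[OF z] by simp
  show ?thesis
    using 1(3,4) v w unfolding T_def \<omega>
    by (simp add: blinfun.diff_left blinfun.diff_right algebra_simps)
qed

end

theorem lemma2p4:
  fixes Q :: "('a, 'e::real_normed_vector) atlas"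
    and \<gamma> :: "('a, 'e) form1"
    and \<Lambda> :: "('a, 'e) cpoint \<Rightarrow> ('a, 'e) cpoint"
  assumes "smooth_manifold Q"
    and "one_form Q \<gamma>"
    and "\<Lambda> = form_map \<gamma> \<circ> fst"
  shows
    "(\<forall>q\<in>points Q. \<forall>x\<in>tangent_space Q q. \<forall>y\<in>tangent_space Q q.
       pullback2 Q (cotangent_bundle Q) (form_map \<gamma>) (canonical_symplectic_form Q) q x y
       = - ext_deriv Q \<gamma> q x y) \<and>
     (\<forall>z\<in>points (cotangent_bundle Q).
     \<forall>v\<in>tangent_space (cotangent_bundle Q) z. \<forall>w\<in>tangent_space (cotangent_bundle Q) z.
       pullback2 (cotangent_bundle Q) (cotangent_bundle Q) \<Lambda> (canonical_symplectic_form Q) z v w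
       = - ext_deriv Q \<gamma> (fst z)
             (tangent_map (cotangent_bundle Q) Q fst z v)
             (tangent_map (cotangent_bundle Q) Q fst z w)) \<and>
     (\<forall>z\<in>points (cotangent_bundle Q). \<Lambda> z = z \<longrightarrow>
     (\<forall>v\<in>tangent_space (cotangent_bundle Q) z. \<forall>w\<in>tangent_space (cotangent_bundle Q) z.
       canonical_symplectic_form Q z
         (tangent_map (cotangent_bundle Q) (cotangent_bundle Q) \<Lambda> z v) w
       = canonical_symplectic_form Q z v
           (\<lambda>c. w c - tangent_map (cotangent_bundle Q) (cotangent_bundle Q) \<Lambda> z w c)
         - ext_deriv Q \<gamma> (fst z)
             (tangent_map (cotangent_bundle Q) Q fst z v)
             (tangent_map (cotangent_bundle Q) Q fst z w)))"
proof -
  interpret fin_dim_smooth_one_form Q \<gamma>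
    using assms(1,2) by unfold_locales (auto simp: smooth_manifold_def fin_dim_def)
  show ?thesis
    \<comment> \<open>\<omega> pairs two vectors at one point; at a fixed point of
      \<open>\<Lambda>\<close> the vector T\<lambda> v is again tangent at \<open>z\<close>, which
      is the setting of the third conjunct.\<close>
    using pullback_form_map pullback_form_map_projection symplectic_form_tangent_map_projection
    unfolding assms(3) by blast
qed

end
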